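(* Let $q$ be a prime power, let $1\le k\le n-1$, and let $S_f\subset\mathbb{P}^n$ be a $k$-flat-transverse-free hypersurface defined by a homogeneous polynomial $f\in\mathbb{F}_q[x_0,\dots,x_n]$. For any $m\ge1$, the cone $S_F\subset\mathbb{P}^{n+m}$ over $S_f$, defined by $F(x_0,\dots,x_{n+m})=f(x_0,\dots,x_n)$, is also $k$-flat-transverse-free.
   Context: $\mathbb{P}^n$ is projective $n$-space over $\overline{\mathbb{F}_q}$. A hypersurface is $S_f=\{f=0\}\subset\mathbb{P}^n$ for a non-constant homogeneous $f\in\mathbb{F}_q[x_0,\dots,x_n]$. At $P\in S_f$ (over $\overline{\mathbb{F}_q}$), the tangent space $T_PS_f$ is the hyperplane $\sum_i\frac{\partial f}{\partial x_i}(P)x_i=0$ if $\nabla f(P)\ne0$, and $T_PS_f=\mathbb{P}^n$ if $\nabla f(P)=0$. A $k$-flat is a $k$-dimensional projective linear subspace cut out by linearly independent linear forms over $\mathbb{F}_q$. A $k$-flat $\pi$ is tangent to $S$ if $\pi\subset T_PS$ for some $P\in S\cap\pi$ (over $\overline{\mathbb{F}_q}$). $S$ is $k$-flat-transverse-free if every $k$-flat (defined over $\mathbb{F}_q$) is tangent to $S$. *)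

theory Defs
  imports "HOL-Algebra.Algebraic_Closure_Type" "HOL-Library.Poly_Mapping"
begin

section \<open>Polynomials in the variables $x_0, x_1, \ldots$\<close>

text \<open>
  A monomial is a finitely supported exponent vector, and a polynomial maps monomials to
  coefficients. The polynomial ring in $x_0, \ldots, x_n$ is the set \<open>mpolys n\<close>; in particular
  \<open>mpolys n \<subseteq> mpolys (n + m)\<close>, and the same object \<open>f\<close> can be read as a polynomial in more
  variables.
\<close>

type_synonym 'a mpoly = "(nat \<Rightarrow>\<^sub>0 nat) \<Rightarrow>\<^sub>0 'a"

definition mpolys :: "nat \<Rightarrow> 'a::zero mpoly set" where
  "mpolys n = {f. \<forall>t \<in> Poly_Mapping.keys f. Poly_Mapping.keys t \<subseteq> {..n}}"

definition monom_degree :: "(nat \<Rightarrow>\<^sub>0 nat) \<Rightarrow> nat" where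
  "monom_degree t = (\<Sum>i \<in> Poly_Mapping.keys t. Poly_Mapping.lookup t i)"

text \<open>The zero polynomial is homogeneous of every degree.\<close>

definition homogeneous :: "nat \<Rightarrow> 'a::zero mpoly \<Rightarrow> bool" where
  "homogeneous d f \<longleftrightarrow> (\<forall>t \<in> Poly_Mapping.keys f. monom_degree t = d)"

definition is_constant :: "'a::zero mpoly \<Rightarrow> bool" where
  "is_constant f \<longleftrightarrow> (\<exists>c. f = Poly_Mapping.single 0 c)"

definition mpoly_scale :: "'a::comm_ring_1 \<Rightarrow> 'a mpoly \<Rightarrow> 'a mpoly" where
  "mpoly_scale c f = Poly_Mapping.single 0 c * f"

definition partial_deriv :: "nat \<Rightarrow> 'a::comm_ring_1 mpoly \<Rightarrow> 'a mpoly" where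
  "partial_deriv i f =
     (\<Sum>t \<in> Poly_Mapping.keys f.
        Poly_Mapping.single (t - Poly_Mapping.single i 1)
          (of_nat (Poly_Mapping.lookup t i) * Poly_Mapping.lookup f t))"

definition eval_ac :: "'a::field mpoly \<Rightarrow> (nat \<Rightarrow> 'a alg_closure) \<Rightarrow> 'a alg_closure" where
  "eval_ac f x =
     (\<Sum>t \<in> Poly_Mapping.keys f.
        to_ac (Poly_Mapping.lookup f t) *
          (\<Prod>i \<in> Poly_Mapping.keys t. x i ^ Poly_Mapping.lookup t i))"


section \<open>Projective space\<close>

text \<open>
  A vector of homogeneous coordinates $(v_0, \ldots, v_n)$ is represented by a function on the
  naturals that is $0$ beyond $n$. A point of projective space is a class of nonzero vectors
  modulo nonzero scalars.
\<close>

definition coord_vecs :: "nat \<Rightarrow> (nat \<Rightarrow> 'b::field) set" where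
  "coord_vecs n = {v. (\<forall>i>n. v i = 0) \<and> (\<exists>i\<le>n. v i \<noteq> 0)}"

definition proj_rel :: "nat \<Rightarrow> ((nat \<Rightarrow> 'b::field) \<times> (nat \<Rightarrow> 'b)) set" where
  "proj_rel n =
     {(v, w). v \<in> coord_vecs n \<and> w \<in> coord_vecs n \<and> (\<exists>c. c \<noteq> 0 \<and> w = (\<lambda>i. c * v i))}"

definition proj_space :: "nat \<Rightarrow> (nat \<Rightarrow> 'b::field) set set" where
  "proj_space n = coord_vecs n // proj_rel n"

lemma equiv_proj_rel: "equiv (coord_vecs n) (proj_rel n :: ((nat \<Rightarrow> 'b::field) \<times> _) set)"
proof (rule equivI)
  show "proj_rel n \<subseteq> coord_vecs n \<times> (coord_vecs n :: (nat \<Rightarrow> 'b) set)"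
    unfolding proj_rel_def by blast
  show "refl_on (coord_vecs n) (proj_rel n :: ((nat \<Rightarrow> 'b) \<times> _) set)"
  proof (rule refl_onI)
    fix v :: "nat \<Rightarrow> 'b"
    assume "v \<in> coord_vecs n"
    moreover have "(1 :: 'b) \<noteq> 0 \<and> v = (\<lambda>i. 1 * v i)"
      by simp
    ultimately show "(v, v) \<in> proj_rel n"
      unfolding proj_rel_def by blast
  qed
  show "sym (proj_rel n :: ((nat \<Rightarrow> 'b) \<times> _) set)"
  proof (rule symI)
    fix v w :: "nat \<Rightarrow> 'b"
    assume "(v, w) \<in> proj_rel n"
    then obtain c where c: "v \<in> coord_vecs n" "w \<in> coord_vecs n" "c \<noteq> 0" "w = (\<lambda>i. c * v i)"
      unfolding proj_rel_def by blast
    then have "inverse c \<noteq> 0 \<and> v = (\<lambda>i. inverse c * w i)"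
      by (simp add: mult.assoc[symmetric])
    with c(1,2) show "(w, v) \<in> proj_rel n"
      unfolding proj_rel_def by blast
  qed
  show "trans (proj_rel n :: ((nat \<Rightarrow> 'b) \<times> _) set)"
  proof (rule transI)
    fix u v w :: "nat \<Rightarrow> 'b"
    assume "(u, v) \<in> proj_rel n" and "(v, w) \<in> proj_rel n"
    then obtain c d where uw: "u \<in> coord_vecs n" "w \<in> coord_vecs n" and cd: "c \<noteq> 0" "d \<noteq> 0"
      "v = (\<lambda>i. c * u i)" "w = (\<lambda>i. d * v i)"
      unfolding proj_rel_def by blast
    from cd have "d * c \<noteq> 0 \<and> w = (\<lambda>i. d * c * u i)"
      by (simp add: mult.assoc)
    with uw show "(u, w) \<in> proj_rel n"
      unfolding proj_rel_def by blast
  qed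
qed

text \<open>The points, over the algebraic closure, at which all members of a set of forms vanish.\<close>

definition zero_locus :: "nat \<Rightarrow> 'a::field mpoly set \<Rightarrow> (nat \<Rightarrow> 'a alg_closure) set set" where
  "zero_locus n L = {P \<in> proj_space n. \<forall>v \<in> P. \<forall>l \<in> L. eval_ac l v = 0}"


section \<open>Hypersurfaces, tangent spaces and flats\<close>

definition defines_hypersurface :: "nat \<Rightarrow> 'a::field mpoly \<Rightarrow> bool" where
  "defines_hypersurface n f \<longleftrightarrow> f \<in> mpolys n \<and> (\<exists>d. homogeneous d f) \<and> \<not> is_constant f"

definition hypersurface :: "nat \<Rightarrow> 'a::field mpoly \<Rightarrow> (nat \<Rightarrow> 'a alg_closure) set set" where
  "hypersurface n f = zero_locus n {f}"

definition gradient_vanishes ::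
    "nat \<Rightarrow> 'a::field mpoly \<Rightarrow> (nat \<Rightarrow> 'a alg_closure) set \<Rightarrow> bool" where
  "gradient_vanishes n f P \<longleftrightarrow> (\<forall>v \<in> P. \<forall>i\<le>n. eval_ac (partial_deriv i f) v = 0)"

text \<open>
  For homogeneous \<open>f\<close> the partial derivatives are homogeneous, so the condition below does not
  depend on the choice of the representatives \<open>v\<close> and \<open>w\<close>.
\<close>

definition tangent_space ::
    "nat \<Rightarrow> 'a::field mpoly \<Rightarrow> (nat \<Rightarrow> 'a alg_closure) set \<Rightarrow> (nat \<Rightarrow> 'a alg_closure) set set"
  where
  "tangent_space n f P =
     (if gradient_vanishes n f P then proj_space n
      else {Q \<in> proj_space n.
              \<forall>v \<in> P. \<forall>w \<in> Q. (\<Sum>i\<le>n. eval_ac (partial_deriv i f) v * w i) = 0})"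

text \<open>
  A flat of dimension \<open>k\<close> is identified with its set of points over the algebraic closure; the \<open>n - k\<close>
  linear forms cutting it out have coefficients in the ground field and are linearly independent
  over it.
\<close>

definition is_flat :: "nat \<Rightarrow> nat \<Rightarrow> (nat \<Rightarrow> 'a::field alg_closure) set set \<Rightarrow> bool" where
  "is_flat n k \<pi> \<longleftrightarrow>
     (\<exists>L :: 'a mpoly set.
        L \<subseteq> {l \<in> mpolys n. homogeneous 1 l} \<and> finite L \<and> card L + k = n \<and>
        \<not> module.dependent mpoly_scale L \<and> \<pi> = zero_locus n L)"

definition tangent_flat ::
    "nat \<Rightarrow> 'a::field mpoly \<Rightarrow> (nat \<Rightarrow> 'a alg_closure) set set \<Rightarrow> bool" where
  "tangent_flat n f \<pi> \<longleftrightarrow> (\<exists>P \<in> hypersurface n f \<inter> \<pi>. \<pi> \<subseteq> tangent_space n f P)"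

definition flat_transverse_free :: "nat \<Rightarrow> nat \<Rightarrow> 'a::field mpoly \<Rightarrow> bool" where
  "flat_transverse_free n k f \<longleftrightarrow> (\<forall>\<pi>. is_flat n k \<pi> \<longrightarrow> tangent_flat n f \<pi>)"

lemma vector_space_mpoly_scale: "vector_space (mpoly_scale :: 'a::field \<Rightarrow> _)"
proof
  fix a b :: 'a and f g :: "'a mpoly"
  show "mpoly_scale a (f + g) = mpoly_scale a f + mpoly_scale a g"
    unfolding mpoly_scale_def by (rule distrib_left)
  show "mpoly_scale (a + b) f = mpoly_scale a f + mpoly_scale b f"
    unfolding mpoly_scale_def single_add by (rule distrib_right)
  have "Poly_Mapping.single (0 :: nat \<Rightarrow>\<^sub>0 nat) a * Poly_Mapping.single 0 b
      = Poly_Mapping.single 0 (a * b)"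
    by (simp only: mult_single add_0)
  then show "mpoly_scale a (mpoly_scale b f) = mpoly_scale (a * b) f"
    unfolding mpoly_scale_def by (metis mult.assoc)
  show "mpoly_scale 1 f = f"
    unfolding mpoly_scale_def by (simp only: single_one mult_1)
qed

end

(*
  One variable is added at a time, and f has degree at least 2 because a hyperplane misses some
  k-flat. If the linear forms cutting out a k-flat do not involve the new variable, then the flat
  contains the vertex of the cone, which is a singular point of the cone. Otherwise one form can be
  solved for the new variable; eliminating the variable from the remaining forms yields a k-flat of
  the base space, and its point of tangency lifts to the original flat.
*)
theory Submission
  imports Defs
begin

section \<open>Polynomials and their values\<close>

text \<open>Written as in \<open>is_flat\<close>, so that it matches there; the zero form belongs to
  it.\<close>

abbreviation linear_forms :: "nat \<Rightarrow> 'a::zero mpoly set" where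
  "linear_forms n \<equiv> {l \<in> mpolys n. homogeneous 1 l}"

abbreviation coeff_var :: "'a::zero mpoly \<Rightarrow> nat \<Rightarrow> 'a" where
  "coeff_var l i \<equiv> Poly_Mapping.lookup l (Poly_Mapping.single i 1)"

lemma mpolys_mono: "n \<le> n' \<Longrightarrow> mpolys n \<subseteq> mpolys n'"
  unfolding mpolys_def by fastforce

lemma monom_degree_single [simp]: "monom_degree (Poly_Mapping.single i a) = a"
  unfolding monom_degree_def by simp

lemma monom_degree_0 [simp]: "monom_degree 0 = 0"
  unfolding monom_degree_def by simp

text \<open>Natural numbers adding up to 1 are all 0 except for a single 1.\<close>

lemma monom_degree_1E:
  assumes "monom_degree t = 1"
  obtains i where "t = Poly_Mapping.single i 1" "i \<in> Poly_Mapping.keys t"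
proof -
  from assms obtain i where i: "i \<in> Poly_Mapping.keys t" "Poly_Mapping.lookup t i = 1"
    and "\<forall>j \<in> Poly_Mapping.keys t. i \<noteq> j \<longrightarrow> Poly_Mapping.lookup t j = 0"
    unfolding monom_degree_def by (auto simp: sum_eq_1_iff simp del: One_nat_def)
  then have "t = Poly_Mapping.single i 1"
    by (intro poly_mapping_eqI) (auto simp: lookup_single when_def in_keys_iff)
  with i that show thesis by blast
qed

text \<open>Coefficients outside the support are 0. Additivity calls for a common index set of two
  polynomials, since keys may cancel in their sum.\<close>

lemma eval_ac_superset:
  assumes "finite S" "Poly_Mapping.keys f \<subseteq> S"
  shows "eval_ac f x = (\<Sum>t\<in>S. to_ac (Poly_Mapping.lookup f t) *
           (\<Prod>i\<in>Poly_Mapping.keys t. x i ^ Poly_Mapping.lookup t i))"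
  unfolding eval_ac_def using assms
  by (intro sum.mono_neutral_left) (auto simp: in_keys_iff)

lemma eval_ac_0 [simp]: "eval_ac 0 x = 0"
  unfolding eval_ac_def by simp

lemma eval_ac_add: "eval_ac (f + g) x = eval_ac f x + eval_ac g x"
  using Poly_Mapping.keys_add[of f g]
  by (simp add: eval_ac_superset[of "Poly_Mapping.keys f \<union> Poly_Mapping.keys g"]
      lookup_add distrib_right sum.distrib)

lemma eval_ac_sum: "eval_ac (sum g A) x = (\<Sum>a\<in>A. eval_ac (g a) x)"
  by (induction A rule: infinite_finite_induct) (simp_all add: eval_ac_add)

lemma eval_ac_single:
  "eval_ac (Poly_Mapping.single t c) x =
     to_ac c * (\<Prod>i\<in>Poly_Mapping.keys t. x i ^ Poly_Mapping.lookup t i)"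
  by (subst eval_ac_superset[of "{t}"]) auto

lemma eval_ac_cong:
  assumes "f \<in> mpolys n" "\<And>i. i \<le> n \<Longrightarrow> x i = y i"
  shows "eval_ac f x = eval_ac f y"
  using assms unfolding eval_ac_def mpolys_def
  by (intro sum.cong prod.cong refl arg_cong2[where f="(*)"]) (auto dest!: subsetD)

section \<open>Partial derivatives and values at the origin\<close>

text \<open>A monomial without x_i survives the truncated subtraction unchanged, but its factor
  \<open>of_nat 0\<close> kills the term.\<close>

lemma eval_ac_partial_deriv:
  "eval_ac (partial_deriv i f) x =
     (\<Sum>t\<in>Poly_Mapping.keys f. of_nat (Poly_Mapping.lookup t i) * to_ac (Poly_Mapping.lookup f t) *
        (\<Prod>j\<in>Poly_Mapping.keys (t - Poly_Mapping.single i 1).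
           x j ^ Poly_Mapping.lookup (t - Poly_Mapping.single i 1) j))"
  unfolding partial_deriv_def by (simp add: eval_ac_sum eval_ac_single)

lemma keys_minus_single_subset:
  "Poly_Mapping.keys (t - Poly_Mapping.single i (1::nat)) \<subseteq> Poly_Mapping.keys t"
  by (auto simp: in_keys_iff lookup_minus)

lemma eval_ac_partial_deriv_cong:
  assumes "f \<in> mpolys n" "\<And>j. j \<le> n \<Longrightarrow> x j = y j"
  shows "eval_ac (partial_deriv i f) x = eval_ac (partial_deriv i f) y"
  unfolding eval_ac_partial_deriv
  using assms keys_minus_single_subset[of _ i] unfolding mpolys_def
  by (intro sum.cong prod.cong refl arg_cong2[where f="(*)"]) (auto dest!: subsetD, metis atMost_iff subsetD)

lemma eval_ac_partial_deriv_beyond: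
  assumes "f \<in> mpolys n" "n < i"
  shows "eval_ac (partial_deriv i f) x = 0"
  unfolding eval_ac_partial_deriv
proof (intro sum.neutral ballI)
  fix t assume "t \<in> Poly_Mapping.keys f"
  with assms have "i \<notin> Poly_Mapping.keys t"
    unfolding mpolys_def by fastforce
  then show "of_nat (Poly_Mapping.lookup t i) * to_ac (Poly_Mapping.lookup f t) *
        (\<Prod>j\<in>Poly_Mapping.keys (t - Poly_Mapping.single i 1).
           x j ^ Poly_Mapping.lookup (t - Poly_Mapping.single i 1) j) = 0"
    by (simp add: in_keys_iff)
qed

text \<open>A monomial of positive degree contains a variable, and a positive power of 0 is 0.
  Coordinates beyond n stay free, so that the vertex of the cone is covered.\<close>

lemma eval_ac_eq_0_at_origin:
  assumes "f \<in> mpolys n" "homogeneous d f" "1 \<le> d" "\<And>i. i \<le> n \<Longrightarrow> x i = 0"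
  shows "eval_ac f x = 0"
  unfolding eval_ac_def
proof (intro sum.neutral ballI)
  fix t assume t: "t \<in> Poly_Mapping.keys f"
  with assms have "t \<noteq> 0" unfolding homogeneous_def by auto
  then obtain i where "i \<in> Poly_Mapping.keys t" using keys_eq_empty by blast
  moreover from this have "x i = 0" using t assms unfolding mpolys_def by fastforce
  ultimately have "(\<Prod>i\<in>Poly_Mapping.keys t. x i ^ Poly_Mapping.lookup t i) = 0"
    by (auto simp: in_keys_iff prod_zero_iff power_0_left intro!: bexI[of _ i])
  then show "to_ac (Poly_Mapping.lookup f t) *
      (\<Prod>i\<in>Poly_Mapping.keys t. x i ^ Poly_Mapping.lookup t i) = 0" by simp
qed

text \<open>Because of \<open>2 \<le> d\<close>, a monomial that contains x_i keeps some variable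
  after differentiation; in degree 1 a constant would remain.\<close>

lemma eval_ac_partial_deriv_eq_0_at_origin:
  assumes "f \<in> mpolys n" "homogeneous d f" "2 \<le> d" "\<And>i. i \<le> n \<Longrightarrow> x i = 0"
  shows "eval_ac (partial_deriv i f) x = 0"
  unfolding eval_ac_partial_deriv
proof (intro sum.neutral ballI)
  fix t assume t: "t \<in> Poly_Mapping.keys f"
  define s where "s = t - Poly_Mapping.single i (1::nat)"
  have "of_nat (Poly_Mapping.lookup t i) * to_ac (Poly_Mapping.lookup f t) *
        (\<Prod>j\<in>Poly_Mapping.keys s. x j ^ Poly_Mapping.lookup s j) = 0"
  proof (cases "Poly_Mapping.lookup t i = 0")
    case False
    have "s \<noteq> 0"
    proof
      assume "s = 0"
      then have "Poly_Mapping.lookup s j = 0" for j by simp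
      \<comment> \<open>Subtraction truncates, so \<open>s = 0\<close> yields only an inequality;
        the positive exponent at i makes it an equality, and t would have degree 1.\<close>
      then have "Poly_Mapping.lookup t j \<le> Poly_Mapping.lookup (Poly_Mapping.single i 1) j" for j
        unfolding s_def lookup_minus by simp
      then have "Poly_Mapping.lookup t j = Poly_Mapping.lookup (Poly_Mapping.single i 1) j" for j
        using False
        by (intro antisym) (auto simp: lookup_single when_def)
      then have "t = Poly_Mapping.single i 1" by (intro poly_mapping_eqI) simp
      with t assms show False unfolding homogeneous_def by force
    qed
    then obtain j where "j \<in> Poly_Mapping.keys s" using keys_eq_empty by blast
    moreover from this have "x j = 0"
      using t assms keys_minus_single_subset[of t i] unfolding mpolys_def s_def by fastforce
    ultimately have "(\<Prod>j\<in>Poly_Mapping.keys s. x j ^ Poly_Mapping.lookup s j) = 0"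
      by (auto simp: in_keys_iff prod_zero_iff power_0_left intro!: bexI[of _ j])
    then show ?thesis by simp
  qed simp
  then show "of_nat (Poly_Mapping.lookup t i) * to_ac (Poly_Mapping.lookup f t) *
        (\<Prod>j\<in>Poly_Mapping.keys (t - Poly_Mapping.single i 1).
           x j ^ Poly_Mapping.lookup (t - Poly_Mapping.single i 1) j) = 0"
    unfolding s_def .
qed

section \<open>Linear forms\<close>

lemma keys_linear_form:
  assumes "l \<in> linear_forms n"
  shows "Poly_Mapping.keys l \<subseteq> (\<lambda>i. Poly_Mapping.single i 1) ` {..n}"
proof
  fix t assume t: "t \<in> Poly_Mapping.keys l"
  with assms have "monom_degree t = 1" unfolding homogeneous_def by simp
  then obtain i where "t = Poly_Mapping.single i 1" "i \<in> Poly_Mapping.keys t"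
    by (rule monom_degree_1E)
  with t assms show "t \<in> (\<lambda>i. Poly_Mapping.single i 1) ` {..n}"
    unfolding mpolys_def by blast
qed

lemma linear_formI:
  assumes "Poly_Mapping.keys l \<subseteq> (\<lambda>i. Poly_Mapping.single i 1) ` {..n}"
  shows "l \<in> linear_forms n"
  using assms unfolding mpolys_def homogeneous_def by fastforce

lemma inj_single_exponent: "inj_on (\<lambda>i. Poly_Mapping.single i (1::nat)) A"
  by (auto intro!: inj_onI simp: poly_mapping_eq_iff fun_eq_iff lookup_single when_def split: if_splits)

lemma eval_ac_linear_form:
  assumes "l \<in> linear_forms n"
  shows "eval_ac l x = (\<Sum>i\<le>n. to_ac (coeff_var l i) * x i)"
proof -
  have "eval_ac l x = (\<Sum>t\<in>(\<lambda>i. Poly_Mapping.single i 1) ` {..n}. to_ac (Poly_Mapping.lookup l t) *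
           (\<Prod>i\<in>Poly_Mapping.keys t. x i ^ Poly_Mapping.lookup t i))"
    using keys_linear_form[OF assms] by (intro eval_ac_superset) auto
  also have "\<dots> = (\<Sum>i\<le>n. to_ac (coeff_var l i) * x i)"
    by (subst sum.reindex[OF inj_single_exponent]) simp
  finally show ?thesis .
qed

lemma eval_ac_linear_form_scale:
  assumes "l \<in> linear_forms n"
  shows "eval_ac l (\<lambda>i. c * x i) = c * eval_ac l x"
  unfolding eval_ac_linear_form[OF assms] by (simp add: sum_distrib_left mult_ac)

lemma lookup_mpoly_scale [simp]:
  "Poly_Mapping.lookup (mpoly_scale c f) t = c * Poly_Mapping.lookup f t"
  unfolding mpoly_scale_def mult_map_scale_conv_mult[symmetric]
  by (simp add: Poly_Mapping.map.rep_eq when_def)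

interpretation mpoly: vector_space mpoly_scale
  by (rule vector_space_mpoly_scale)

lemma linear_form_diff_scale:
  assumes "l \<in> linear_forms n" "l' \<in> linear_forms n"
  shows "l - mpoly_scale a l' \<in> linear_forms n"
proof (rule linear_formI, rule subsetI)
  fix t assume "t \<in> Poly_Mapping.keys (l - mpoly_scale a l')"
  then have "t \<in> Poly_Mapping.keys l \<or> t \<in> Poly_Mapping.keys l'"
    by (auto simp: in_keys_iff lookup_minus)
  then show "t \<in> (\<lambda>i. Poly_Mapping.single i 1) ` {..n}"
    using keys_linear_form assms by blast
qed

lemma linear_form_Suc_iff:
  assumes "l \<in> linear_forms (Suc n)"
  shows "l \<in> linear_forms n \<longleftrightarrow> coeff_var l (Suc n) = 0"
proof
  assume "l \<in> linear_forms n"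
  then have "Poly_Mapping.single (Suc n) 1 \<notin> Poly_Mapping.keys l"
    unfolding mpolys_def by fastforce
  then show "coeff_var l (Suc n) = 0" by (simp add: in_keys_iff)
next
  assume "coeff_var l (Suc n) = 0"
  then have "Poly_Mapping.single (Suc n) 1 \<notin> Poly_Mapping.keys l" by (simp add: in_keys_iff)
  with keys_linear_form[OF assms] show "l \<in> linear_forms n"
    by (intro linear_formI) (auto simp: atMost_Suc)
qed

section \<open>Elimination of the last variable\<close>

text \<open>Gaussian elimination with pivot x: the scalar is the one that cancels the coefficient of
  the last variable.\<close>

lemma linear_form_eliminate:
  fixes l :: "'a::field mpoly"
  assumes "l \<in> linear_forms (Suc n)" "x \<in> linear_forms (Suc n)" "coeff_var x (Suc n) \<noteq> 0"
  shows "l - mpoly_scale (coeff_var l (Suc n) / coeff_var x (Suc n)) x \<in> linear_forms n"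
  using linear_form_Suc_iff[OF linear_form_diff_scale[OF assms(1,2)]] assms(3)
  by (simp only: lookup_minus lookup_mpoly_scale nonzero_eq_divide_eq[symmetric]) simp

lemma eval_ac_linear_form_diff_scale:
  assumes "l \<in> linear_forms n" "l' \<in> linear_forms n"
  shows "eval_ac (l - mpoly_scale a l') x = eval_ac l x - to_ac a * eval_ac l' x"
  unfolding eval_ac_linear_form[OF linear_form_diff_scale[OF assms]]
    eval_ac_linear_form[OF assms(1)] eval_ac_linear_form[OF assms(2)]
  by (simp add: lookup_minus sum_distrib_left sum_subtractf algebra_simps)

text \<open>A relation among the new vectors is a relation on L with the same coefficients off the
  pivot x. Injectivity allows the remaining forms to be counted.\<close>

lemma (in vector_space) independent_eliminate:
  fixes a :: "'b \<Rightarrow> 'a"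
  assumes L: "independent L" "finite L" and x: "x \<in> L"
  defines "g \<equiv> \<lambda>l. l - scale (a l) x"
  shows "independent (g ` (L - {x}))" and "inj_on g (L - {x})"
proof -
  show inj: "inj_on g (L - {x})"
  proof (rule inj_onI, rule ccontr)
    fix l l' assume l: "l \<in> L - {x}" "l' \<in> L - {x}" "g l = g l'" "l \<noteq> l'"
    \<comment> \<open>A collision would put l in the span of l' and the pivot, both different from
      l.\<close>
    then have "l = l' + scale (a l - a l') x"
      unfolding g_def by (simp add: scale_left_diff_distrib algebra_simps)
    moreover have "l' + scale (a l - a l') x \<in> span (L - {l})"
      using l x by (intro span_add span_scale span_base) auto
    ultimately show False using L(1) l unfolding dependent_def by auto
  qed
  show "independent (g ` (L - {x}))"
  proof
    assume "dependent (g ` (L - {x}))"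
    then obtain u where u: "\<exists>v\<in>g ` (L - {x}). u v \<noteq> 0" "(\<Sum>v\<in>g ` (L - {x}). scale (u v) v) = 0"
      using L(2) by (subst (asm) dependent_finite) auto
    then obtain l where l: "l \<in> L - {x}" "u (g l) \<noteq> 0" by auto
    \<comment> \<open>All multiples of the pivot are collected into one coefficient; off the pivot
      \<open>w\<close> is the given \<open>u (g l)\<close>, so it is not identically zero.\<close>
    define w where "w = (\<lambda>l. if l = x then - (\<Sum>l\<in>L - {x}. u (g l) * a l) else u (g l))"
    have "0 = (\<Sum>l\<in>L - {x}. scale (u (g l)) (g l))"
      using u(2) by (simp add: sum.reindex[OF inj])
    also have "\<dots> = (\<Sum>l\<in>L - {x}. scale (w l) l) + scale (w x) x"
      unfolding g_def w_def
      by (simp add: scale_right_diff_distrib sum_subtractf scale_sum_left)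
    also have "\<dots> = (\<Sum>l\<in>L. scale (w l) l)"
      using L(2) x by (simp add: sum.remove[of L x])
    finally have "(\<Sum>l\<in>L. scale (w l) l) = 0" by simp
    with L have "w l = 0" using l by (intro independentD[of L L w l]) auto
    with l show False unfolding w_def by auto
  qed
qed

section \<open>Gradients of linear forms and independence of the variables\<close>

text \<open>Among the monomials only x_j contributes, and its derivative is the empty product. The
  gradient is thus the same at all points.\<close>

lemma eval_ac_partial_deriv_linear_form:
  assumes "l \<in> linear_forms n" "j \<le> n"
  shows "eval_ac (partial_deriv j l) x = to_ac (coeff_var l j)"
proof -
  let ?h = "\<lambda>t. of_nat (Poly_Mapping.lookup t j) * to_ac (Poly_Mapping.lookup l t) *
        (\<Prod>i\<in>Poly_Mapping.keys (t - Poly_Mapping.single j 1).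
           x i ^ Poly_Mapping.lookup (t - Poly_Mapping.single j 1) i)"
  have "eval_ac (partial_deriv j l) x = (\<Sum>t\<in>(\<lambda>i. Poly_Mapping.single i 1) ` {..n}. ?h t)"
    unfolding eval_ac_partial_deriv using keys_linear_form[OF assms(1)]
    by (intro sum.mono_neutral_left) (auto simp: in_keys_iff)
  also have "\<dots> = (\<Sum>i\<le>n. if i = j then to_ac (coeff_var l j) else 0)"
    unfolding sum.reindex[OF inj_single_exponent] o_def
    by (rule sum.cong) (auto simp: lookup_single when_def)
  also have "\<dots> = to_ac (coeff_var l j)"
    using assms(2) by simp
  finally show ?thesis .
qed

text \<open>The coefficient of x_j in a relation isolates the scalar of x_j. Injectivity gives the
  number of forms, hence the dimension of the flat they cut out.\<close>

lemma independent_variables: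
  assumes "finite J"
  shows "mpoly.independent ((\<lambda>j. Poly_Mapping.single (Poly_Mapping.single j (1::nat)) (1 :: 'a::field)) ` J)"
    (is "mpoly.independent (?X ` J)")
    and "inj_on (\<lambda>j. Poly_Mapping.single (Poly_Mapping.single j (1::nat)) (1 :: 'a)) J"
proof -
  have single_eq: "Poly_Mapping.single i (1::nat) = Poly_Mapping.single j 1 \<longleftrightarrow> i = j" for i j :: nat
    using inj_single_exponent[of UNIV] by (auto dest: injD)
  show inj: "inj_on ?X J"
  proof (rule inj_onI)
    fix i j assume "?X i = ?X j"
    then have "Poly_Mapping.keys (?X i) = Poly_Mapping.keys (?X j)" by simp
    then show "i = j" using single_eq by simp
  qed
  show "mpoly.independent (?X ` J)"
  proof
    assume "mpoly.dependent (?X ` J)"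
    then obtain u where u: "\<exists>v\<in>?X ` J. u v \<noteq> 0" "(\<Sum>v\<in>?X ` J. mpoly_scale (u v) v) = 0"
      using assms by (subst (asm) mpoly.dependent_finite) auto
    then obtain j where j: "j \<in> J" "u (?X j) \<noteq> 0" by auto
    have "0 = Poly_Mapping.lookup (\<Sum>i\<in>J. mpoly_scale (u (?X i)) (?X i)) (Poly_Mapping.single j 1)"
      using u(2) unfolding sum.reindex[OF inj] o_def by simp
    also have "\<dots> = (\<Sum>i\<in>J. if i = j then u (?X j) else 0)"
      unfolding lookup_sum lookup_mpoly_scale lookup_single single_eq
      by (intro sum.cong) (auto simp: when_def)
    also have "\<dots> = u (?X j)" using assms j by simp
    finally show False using j by simp
  qed
qed

section \<open>Points and flats\<close>

text \<open>The class of v; it is empty if v is not in \<open>coord_vecs n\<close>.\<close>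

abbreviation proj_point :: "nat \<Rightarrow> (nat \<Rightarrow> 'b::field) \<Rightarrow> (nat \<Rightarrow> 'b) set" where
  "proj_point n v \<equiv> proj_rel n `` {v}"

lemma proj_point_in_proj_space: "v \<in> coord_vecs n \<Longrightarrow> proj_point n v \<in> proj_space n"
  unfolding proj_space_def by (rule quotientI)

lemma proj_spaceE:
  assumes "P \<in> proj_space n"
  obtains v where "v \<in> coord_vecs n" "P = proj_point n v"
  using assms unfolding proj_space_def by (elim quotientE) blast

lemma mem_proj_point_iff:
  assumes "v \<in> coord_vecs n"
  shows "w \<in> proj_point n v \<longleftrightarrow> (\<exists>c. c \<noteq> 0 \<and> w = (\<lambda>i. c * v i))"
  using assms unfolding proj_rel_def coord_vecs_def by auto

lemma self_mem_proj_point: "v \<in> coord_vecs n \<Longrightarrow> v \<in> proj_point n v"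
  using equiv_class_self[OF equiv_proj_rel] .

text \<open>Membership in \<open>zero_locus\<close> speaks of all representatives; linear forms
  scale, so a check at one of them suffices.\<close>

lemma proj_point_in_zero_locus:
  assumes "v \<in> coord_vecs n" "L \<subseteq> linear_forms n" "\<And>l. l \<in> L \<Longrightarrow> eval_ac l v = 0"
  shows "proj_point n v \<in> zero_locus n L"
  unfolding zero_locus_def
proof (intro CollectI conjI ballI)
  show "proj_point n v \<in> proj_space n" using assms(1) by (rule proj_point_in_proj_space)
next
  fix w l assume w: "w \<in> proj_point n v" and l: "l \<in> L"
  from w obtain c where "w = (\<lambda>i. c * v i)" using mem_proj_point_iff[OF assms(1)] by blast
  moreover have "l \<in> linear_forms n" using l assms(2) by blast
  ultimately show "eval_ac l w = 0" using assms(3)[OF l] eval_ac_linear_form_scale[of l n c v] by simp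
qed

text \<open>A hyperplane is its own tangent space everywhere, and some flat over the ground field is not
  contained in it.\<close>

lemma linear_form_not_flat_transverse_free:
  fixes f :: "'a::field mpoly"
  assumes f: "f \<in> linear_forms n" "f \<noteq> 0" and "k \<le> n"
  shows "\<not> flat_transverse_free n k f"
proof
  assume tf: "flat_transverse_free n k f"
  from f(2) obtain t where "t \<in> Poly_Mapping.keys f" using keys_eq_empty by blast
  with keys_linear_form[OF f(1)] obtain i where i: "i \<le> n" "coeff_var f i \<noteq> 0"
    by (auto simp: in_keys_iff)
  \<comment> \<open>The variable x_i occurs in f. Any n - k of the other variables cut out a k-flat
    through the i-th coordinate point, where f does not vanish.\<close>
  have "n - k \<le> card ({..n} - {i})" using i by simp
  then obtain J where J: "J \<subseteq> {..n} - {i}" "card J = n - k" "finite J"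
    by (rule obtain_subset_with_card_n)
  define L where "L = (\<lambda>j. Poly_Mapping.single (Poly_Mapping.single j (1::nat)) (1 :: 'a)) ` J"
  define e :: "nat \<Rightarrow> 'a alg_closure" where "e = (\<lambda>j. if j = i then 1 else 0)"
  have L: "L \<subseteq> linear_forms n"
    unfolding L_def by (intro image_subsetI linear_formI) (use J(1) in auto)
  have e: "e \<in> coord_vecs n" using i unfolding e_def coord_vecs_def by auto
  have "is_flat n k (zero_locus n L)"
    unfolding is_flat_def
    using L J \<open>k \<le> n\<close> independent_variables[OF J(3), where 'a='a]
    by (intro exI[of _ L]) (simp add: L_def card_image)
  with tf obtain P where P: "P \<in> proj_space n" "zero_locus n L \<subseteq> tangent_space n f P"
    unfolding flat_transverse_free_def tangent_flat_def hypersurface_def zero_locus_def by blast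
  obtain v where v: "v \<in> P" using P(1) self_mem_proj_point by (metis proj_spaceE)
  have grad: "eval_ac (partial_deriv j f) v = to_ac (coeff_var f j)" if "j \<le> n" for j
    using eval_ac_partial_deriv_linear_form[OF f(1) that] .
  have "proj_point n e \<in> zero_locus n L"
    using e L J(1) by (intro proj_point_in_zero_locus) (auto simp: L_def eval_ac_single e_def)
  with P(2) have "proj_point n e \<in> tangent_space n f P" by blast
  \<comment> \<open>The coefficient of x_i is a nonzero partial derivative, so the tangent space is
    a hyperplane and not the whole space.\<close>
  moreover have "\<not> gradient_vanishes n f P"
    using v i grad[of i] unfolding gradient_vanishes_def by fastforce
  ultimately have "(\<Sum>j\<le>n. eval_ac (partial_deriv j f) v * e j) = 0"
    using v self_mem_proj_point[OF e] unfolding tangent_space_def by auto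
  moreover have "(\<Sum>j\<le>n. eval_ac (partial_deriv j f) v * e j)
      = (\<Sum>j\<le>n. if j = i then to_ac (coeff_var f i) else 0)"
    by (intro sum.cong) (auto simp: e_def grad)
  ultimately show False using i by simp
qed

section \<open>Adding one variable\<close>

text \<open>Projection from the vertex of the cone, which is defined wherever the first n + 1
  coordinates do not all vanish.\<close>

lemma truncate_in_coord_vecs:
  assumes "u \<in> coord_vecs (Suc n)" "\<exists>i\<le>n. u i \<noteq> 0"
  shows "u(Suc n := 0) \<in> coord_vecs n"
proof -
  from assms(2) obtain i where "i \<le> n" "(u(Suc n := 0)) i \<noteq> 0" by auto
  moreover from assms(1) have "\<forall>i>n. (u(Suc n := 0)) i = 0"
    unfolding coord_vecs_def by (auto intro: Suc_lessI)
  ultimately show ?thesis unfolding coord_vecs_def by blast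
qed

text \<open>The vertex lies on the flat and on the cone because positive-degree forms in x_0, ...,
  x_n vanish there. By \<open>2 \<le> d\<close> the gradient vanishes too, so the tangent space is
  everything.\<close>

lemma tangent_flat_through_vertex:
  fixes f :: "'a::field mpoly"
  assumes f: "f \<in> mpolys n" "homogeneous d f" "2 \<le> d"
    and L: "L \<subseteq> linear_forms n"
  shows "tangent_flat (Suc n) f (zero_locus (Suc n) L)"
proof -
  \<comment> \<open>The vertex (0 : ... : 0 : 1).\<close>
  define e :: "nat \<Rightarrow> 'a alg_closure" where "e = (\<lambda>j. if j = Suc n then 1 else 0)"
  have e: "e \<in> coord_vecs (Suc n)" unfolding e_def coord_vecs_def by auto
  define P where "P = proj_point (Suc n) e"
  have P: "P \<in> proj_space (Suc n)"
    unfolding P_def using e by (rule proj_point_in_proj_space)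
  have P0: "v i = 0" if "v \<in> P" "i \<le> n" for v i
    using that mem_proj_point_iff[OF e] unfolding P_def e_def by auto
  have "eval_ac l v = 0" if "v \<in> P" "l \<in> L" for v l
    using that L P0 by (intro eval_ac_eq_0_at_origin[of l n 1]) auto
  moreover have "eval_ac f v = 0" if "v \<in> P" for v
    using that f P0 by (intro eval_ac_eq_0_at_origin[of f n d]) auto
  moreover have "gradient_vanishes (Suc n) f P"
    unfolding gradient_vanishes_def
    using f P0 by (auto intro!: eval_ac_partial_deriv_eq_0_at_origin[of f n d])
  ultimately show ?thesis
    using P unfolding tangent_flat_def hypersurface_def tangent_space_def zero_locus_def by auto
qed

text \<open>A flat that misses the vertex projects isomorphically onto a flat of the base, and the tangent
  space of the cone at a point is the preimage of the tangent space at the projected point.\<close>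

lemma tangent_flat_lift:
  fixes f :: "'a::field mpoly"
  assumes f: "f \<in> mpolys n"
    and x: "x \<in> L" "coeff_var x (Suc n) \<noteq> 0" and L: "L \<subseteq> linear_forms (Suc n)"
  defines "g \<equiv> \<lambda>l. l - mpoly_scale (coeff_var l (Suc n) / coeff_var x (Suc n)) x"
  assumes tangent: "tangent_flat n f (zero_locus n (g ` (L - {x})))"
  shows "tangent_flat (Suc n) f (zero_locus (Suc n) L)"
proof -
  have xl: "x \<in> linear_forms (Suc n)" using x L by blast
  let ?L' = "g ` (L - {x})"
  let ?tr = "\<lambda>u :: nat \<Rightarrow> 'a alg_closure. u(Suc n := 0)"
  have g_lin: "g l \<in> linear_forms n" if "l \<in> L" for l
    unfolding g_def using that L xl x(2) by (intro linear_form_eliminate) auto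
  have eval_g: "eval_ac (g l) u
      = eval_ac l u - to_ac (coeff_var l (Suc n) / coeff_var x (Suc n)) * eval_ac x u"
    if "l \<in> L" for l u
    unfolding g_def using that L xl by (intro eval_ac_linear_form_diff_scale) auto
  have eval_g_tr: "eval_ac (g l) (?tr u) = eval_ac (g l) u" if "l \<in> L" for l u
    using g_lin[OF that] by (intro eval_ac_cong[of _ n]) auto
  have eval_x: "eval_ac x u
      = (\<Sum>i\<le>n. to_ac (coeff_var x i) * u i) + to_ac (coeff_var x (Suc n)) * u (Suc n)" for u
    using eval_ac_linear_form[OF xl] by simp
  from tangent obtain P' where P': "P' \<in> hypersurface n f" "P' \<in> zero_locus n ?L'"
    "zero_locus n ?L' \<subseteq> tangent_space n f P'"
    unfolding tangent_flat_def by blast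
  from P'(2) obtain v where v: "v \<in> coord_vecs n" "P' = proj_point n v"
    unfolding zero_locus_def by (auto elim: proj_spaceE)
  \<comment> \<open>The lift of v: the last coordinate is obtained by solving the equation of x for
    it.\<close>
  define w where "w = v(Suc n := - (\<Sum>i\<le>n. to_ac (coeff_var x i) * v i) / to_ac (coeff_var x (Suc n)))"
  define P where "P = proj_point (Suc n) w"
  have w: "w \<in> coord_vecs (Suc n)"
  proof -
    from v(1) obtain i where "i \<le> n" "v i \<noteq> 0" unfolding coord_vecs_def by blast
    then have "i \<le> Suc n" "w i \<noteq> 0" unfolding w_def by auto
    moreover have "\<forall>i>Suc n. w i = 0" using v(1) unfolding w_def coord_vecs_def by auto
    ultimately show ?thesis unfolding coord_vecs_def by blast
  qed
  have xw: "eval_ac x w = 0"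
    using x(2) unfolding eval_x by (simp add: w_def)
  have v_tr: "?tr w = v" using v(1) unfolding w_def coord_vecs_def by (auto simp: fun_eq_iff)
  have tr_P: "?tr u \<in> P'" if "u \<in> P" for u
  proof -
    from that obtain c where "c \<noteq> 0" "u = (\<lambda>i. c * w i)"
      using mem_proj_point_iff[OF w] unfolding P_def by blast
    moreover from this have "?tr u = (\<lambda>i. c * ?tr w i)" by auto
    ultimately show ?thesis using mem_proj_point_iff[OF v(1)] v(2) unfolding v_tr by blast
  qed
  \<comment> \<open>Where x vanishes, l and \<open>g l\<close> agree, and \<open>g l\<close> sees
    only the truncation v.\<close>
  have "eval_ac l w = 0" if l: "l \<in> L" for l
  proof (cases "l = x")
    case False
    then have "eval_ac (g l) v = 0"
      using P'(2) l self_mem_proj_point[OF v(1)] v(2) unfolding zero_locus_def by blast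
    then show ?thesis using eval_g_tr[OF l, of w] eval_g[OF l, of w] v_tr xw by simp
  qed (use xw in simp)
  with w L have P_L: "P \<in> zero_locus (Suc n) L"
    unfolding P_def by (intro proj_point_in_zero_locus)
  \<comment> \<open>Neither f nor its derivatives involve the new variable: the gradient at a point
    is the gradient at its truncation, extended by 0.\<close>
  have f_tr: "eval_ac f u = eval_ac f (?tr u)" for u
    using f by (intro eval_ac_cong[of _ n]) auto
  have df_tr: "eval_ac (partial_deriv i f) u = eval_ac (partial_deriv i f) (?tr u)" for i u
    using f by (intro eval_ac_partial_deriv_cong[of _ n]) auto
  have df_Suc: "eval_ac (partial_deriv (Suc n) f) u = 0" for u
    using f by (intro eval_ac_partial_deriv_beyond[of _ n]) auto
  have P_f: "P \<in> hypersurface (Suc n) f"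
    using P_L P'(1) tr_P f_tr unfolding hypersurface_def zero_locus_def by force
  have "zero_locus (Suc n) L \<subseteq> tangent_space (Suc n) f P"
  proof (cases "gradient_vanishes n f P'")
    case True
    then have "gradient_vanishes (Suc n) f P"
      unfolding gradient_vanishes_def using tr_P df_tr df_Suc by (metis le_Suc_eq)
    then show ?thesis unfolding tangent_space_def zero_locus_def by auto
  next
    case False
    have "(\<Sum>i\<le>Suc n. eval_ac (partial_deriv i f) p * u i) = 0"
      if Q: "Q \<in> zero_locus (Suc n) L" and p: "p \<in> P" and u: "u \<in> Q" for Q p u
    proof -
      have Lu: "eval_ac l u = 0" if "l \<in> L" for l
        using Q u that unfolding zero_locus_def by blast
      have "Q \<in> proj_space (Suc n)" using Q unfolding zero_locus_def by blast
      then have u_vec: "u \<in> coord_vecs (Suc n)"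
        using u unfolding proj_space_def quotient_def proj_rel_def by blast
      \<comment> \<open>The flat misses the vertex: if the first n + 1 coordinates vanish, x reduces
        to a nonzero multiple of the last one, which then vanishes as well.\<close>
      have "\<exists>i\<le>n. u i \<noteq> 0"
      proof (rule ccontr)
        assume *: "\<not> (\<exists>i\<le>n. u i \<noteq> 0)"
        then have "to_ac (coeff_var x (Suc n)) * u (Suc n) = 0"
          using Lu[OF x(1)] eval_x[of u] by simp
        then show False using * x(2) u_vec unfolding coord_vecs_def by (auto simp: le_Suc_eq)
      qed
      with u_vec have tr_u: "?tr u \<in> coord_vecs n" by (rule truncate_in_coord_vecs)
      have "proj_point n (?tr u) \<in> zero_locus n ?L'"
      proof (rule proj_point_in_zero_locus[OF tr_u])
        show "?L' \<subseteq> linear_forms n" using g_lin by blast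
        fix h assume "h \<in> ?L'"
        then obtain l where "l \<in> L" "h = g l" by blast
        then show "eval_ac h (?tr u) = 0" using eval_g_tr eval_g Lu x(1) by simp
      qed
      then have "proj_point n (?tr u) \<in> tangent_space n f P'" using P'(3) by blast
      then have "\<forall>a\<in>P'. \<forall>b\<in>proj_point n (?tr u).
          (\<Sum>i\<le>n. eval_ac (partial_deriv i f) a * b i) = 0"
        using False unfolding tangent_space_def by simp
      then have "(\<Sum>i\<le>n. eval_ac (partial_deriv i f) (?tr p) * ?tr u i) = 0"
        using tr_P[OF p] self_mem_proj_point[OF tr_u] by blast
      moreover have "(\<Sum>i\<le>n. eval_ac (partial_deriv i f) (?tr p) * ?tr u i)
          = (\<Sum>i\<le>n. eval_ac (partial_deriv i f) p * u i)"
        using df_tr by (intro sum.cong) auto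
      ultimately show ?thesis using df_Suc by simp
    qed
    then show ?thesis unfolding tangent_space_def zero_locus_def by auto
  qed
  with P_f P_L show ?thesis unfolding tangent_flat_def by blast
qed

text \<open>With k fixed, a k-flat in the larger space needs one more form. Elimination uses up
  exactly one, the pivot, so the remaining n - k forms cut out a k-flat of the base.\<close>

lemma flat_transverse_free_Suc:
  fixes f :: "'a::field mpoly"
  assumes f: "f \<in> mpolys n" "homogeneous d f" "2 \<le> d" and tf: "flat_transverse_free n k f"
  shows "flat_transverse_free (Suc n) k f"
  unfolding flat_transverse_free_def
proof (intro allI impI)
  fix \<pi> :: "(nat \<Rightarrow> 'a alg_closure) set set"
  assume "is_flat (Suc n) k \<pi>"
  then obtain L :: "'a mpoly set" where L: "L \<subseteq> linear_forms (Suc n)" "finite L"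
    "card L + k = Suc n" "mpoly.independent L" and \<pi>: "\<pi> = zero_locus (Suc n) L"
    unfolding is_flat_def by blast
  show "tangent_flat (Suc n) f \<pi>"
  proof (cases "\<forall>l\<in>L. coeff_var l (Suc n) = 0")
    case True
    then have "L \<subseteq> linear_forms n" using L(1) linear_form_Suc_iff by blast
    with f show ?thesis unfolding \<pi> by (rule tangent_flat_through_vertex)
  next
    case False
    then obtain x where x: "x \<in> L" "coeff_var x (Suc n) \<noteq> 0" by blast
    define a where "a = (\<lambda>l. coeff_var l (Suc n) / coeff_var x (Suc n))"
    define L' where "L' = (\<lambda>l. l - mpoly_scale (a l) x) ` (L - {x})"
    note elim = mpoly.independent_eliminate[OF L(4,2) x(1), of a]
    have "L' \<subseteq> linear_forms n"
      unfolding L'_def a_def using L(1) x by (intro image_subsetI linear_form_eliminate) auto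
    moreover have "card L' + k = n"
      using elim(2) L(2,3) x(1) card_gt_0_iff[of L] unfolding L'_def by (auto simp: card_image)
    moreover have "mpoly.independent L'" "finite L'"
      using elim(1) L(2) unfolding L'_def by auto
    ultimately have "is_flat n k (zero_locus n L')"
      unfolding is_flat_def by blast
    with tf have "tangent_flat n f (zero_locus n L')" unfolding flat_transverse_free_def by blast
    then show ?thesis
      unfolding \<pi> L'_def a_def by (rule tangent_flat_lift[OF f(1) x L(1)])
  qed
qed

section \<open>Cones with m new variables\<close>

text \<open>A cone over a cone is again a cone, and the degree d stays the same at each step of the
  induction.\<close>

lemma flat_transverse_free_add:
  fixes f :: "'a::field mpoly"
  assumes "f \<in> mpolys n" "homogeneous d f" "2 \<le> d" "flat_transverse_free n k f"
  shows "flat_transverse_free (n + m) k f"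
proof (induction m)
  case (Suc m)
  have "f \<in> mpolys (n + m)" using assms(1) mpolys_mono[of n "n + m"] by auto
  with assms Suc show ?case by (auto intro: flat_transverse_free_Suc)
qed (use assms in simp)

text \<open>The ring in fewer variables is a subset of the larger one, so the polynomial of the cone
  is the same object as f.\<close>

theorem theorem4p4:
  fixes f F :: "'a::finite_field mpoly"
    and n m k :: nat
  assumes "1 \<le> k" and "k \<le> n - 1" and "1 \<le> m"
    and "defines_hypersurface n f"
    and "flat_transverse_free n k f"
    and "F = f"
  shows "defines_hypersurface (n + m) F \<and> flat_transverse_free (n + m) k F"
proof -
  from assms(4) obtain d where f: "f \<in> mpolys n" "homogeneous d f" "\<not> is_constant f"
    unfolding defines_hypersurface_def by blast
  \<comment> \<open>The zero polynomial counts as a linear form, so it is excluded before the case d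
    = 1.\<close>
  have "f \<noteq> 0" using f(3) unfolding is_constant_def by (metis single_zero)
  \<comment> \<open>In degree 0 the only possible monomial is 1, which makes f constant.\<close>
  have "d \<noteq> 0"
  proof
    assume "d = 0"
    have "t = 0" if "t \<in> Poly_Mapping.keys f" for t
      using that f(2) \<open>d = 0\<close> unfolding homogeneous_def monom_degree_def
      by (auto simp: in_keys_iff intro!: poly_mapping_eqI)
    then have "f = Poly_Mapping.single 0 (Poly_Mapping.lookup f 0)"
      by (intro poly_mapping_eqI) (auto simp: lookup_single when_def in_keys_iff)
    with f(3) show False unfolding is_constant_def by blast
  qed
  moreover have "k \<le> n" using assms(2) by linarith
  \<comment> \<open>In degree 1 some k-flat is not tangent to the hyperplane. Degree at least 2 is
    what makes the vertex singular.\<close>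
  then have "d \<noteq> 1"
    using linear_form_not_flat_transverse_free[of f n k] f \<open>f \<noteq> 0\<close> assms(5) by auto
  ultimately have "2 \<le> d" by simp
  moreover have "f \<in> mpolys (n + m)" using f(1) mpolys_mono[of n "n + m"] by auto
  ultimately show ?thesis
    using f assms(5,6) flat_transverse_free_add unfolding defines_hypersurface_def by blast
qed

end
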